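(* In the linear-quadratic network game with endogenous links described in the context, let $(\boldsymbol{\beta}^*,\boldsymbol{\sigma}^* )$ be an optimal subsidy such that (1) the equilibrium selection $(\boldsymbol{\beta},\boldsymbol{\sigma})\mapsto(\boldsymbol{a}^*(\boldsymbol{\beta},\boldsymbol{\sigma}),\boldsymbol{g}^*(\boldsymbol{\beta},\boldsymbol{\sigma}))$ is differentiable in a neighborhood of $(\boldsymbol{\beta}^*,\boldsymbol{\sigma}^* )$, and (2) the planner's budget constraint strictly binds at $(\boldsymbol{\beta}^*,\boldsymbol{\sigma}^* )$. Let $i\neq j$ be agents. If $s_{ij}\ge 0$, then $\sigma_{ij}^*=\sigma_{ji}^*=0$.
   Context: **Game.** There are $n$ agents $\mathcal{N}=\{1,\dots,n\}$. Simultaneously, each agent $i$ chooses an action $a_i\ge 0$ and link intensities $g_{ij}\ge 0$ for all $j\in\mathcal{N}\setminus\{i\}$. Link strengths are $G_{ij}=G_{ji}=g_{ij}+g_{ji}$ for $i\ne j$, and $G_{ii}=0$. Parameters: $b_i>0$, $\rho>0$, $s_{ij}=s_{ji}\in\mathbb{R}$, $f_{ij}=f_{ji}>0$. Agent $i$'s utility without subsidies is $$U_i(\boldsymbol{a},\boldsymbol{g})=b_ia_i+\rho\sum_{j\ne i}G_{ij}a_ia_j-\frac{a_i^2}{2}+\sum_{j\neq i}s_{ij}G_{ij}-\sum_{j\ne i}\frac{f_{ij}g_{ij}^2}{2}.$$ **Subsidies.** A subsidy (intervention) is $(\boldsymbol{\beta},\boldsymbol{\sigma})$ with $\beta_i\ge0$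 for $i\in\mathcal N$ and $\sigma_{ij}\ge0$ for ordered pairs $i\ne j$ (not necessarily symmetric). Under it agent $i$'s utility is $\mathcal{U}_i=U_i(\boldsymbol a,\boldsymbol g)+\beta_ia_i+\sum_{j\ne i}\sigma_{ij}G_{ij}$, and the planner pays $\mathcal{P}=\sum_i\beta_ia_i+\sum_i\sum_{j\ne i}\sigma_{ij}G_{ij}$. Agents play a pure strategy Nash equilibrium of the game with utilities $\mathcal U_i$. An equilibrium selection $(\boldsymbol{a}^*(\boldsymbol{\beta},\boldsymbol{\sigma}),\boldsymbol{g}^*(\boldsymbol{\beta},\boldsymbol{\sigma}))$ is fixed (it assigns a pure Nash equilibrium to each subsidy for which one exists; welfare is set to $-\infty$ where none exists). **Planner.** The objective $\mathcal{W}(\boldsymbol a)$ is differentiable and strictly increasing in each argument; the budget is $\mathcal{B}>0$. A subsidy is optimal if an equilibrium exists under it, $\mathcal{P}\le\mathcal{B}$ at the selected equilibrium, and it maximizes $\mathcal{W}(\boldsymbol{a}^*(\boldsymbol{\beta},\boldsymbol{\sigma}))$ among subsidies satisfying the budget constraint at the selected equilibrium. **Conventions.** Neighborhoods and derivatives in $(\boldsymbol\beta,\boldsymbol\sigma)$ are relative to the set of nonnegative subsidies (one-sided at the boundary). The budget constraint *strictly binds* at $(\boldsymbol{\beta}^*,\boldsymbol{\sigma}^* )$ if $\mathcal P=\mathcal B$ there and the Karush–Kuhn–Tucker first-order conditions hold there with a strictly positive multiplier: there is $\lambda>0$ such that, viewing $\mathcal{L}=\mathcal{W}-\lambda\mathcal{P}$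 (evaluated at the selected equilibrium) as a function of $(\boldsymbol\beta,\boldsymbol\sigma)$, at $(\boldsymbol{\beta}^*,\boldsymbol{\sigma}^* )$ one has $\frac{d\mathcal L}{d\beta_k}\le0$ with equality if $\beta_k^*>0$, and $\frac{d\mathcal L}{d\sigma_{kl}}\le0$ with equality if $\sigma_{kl}^*>0$, for all $k$ and all $k\neq l$. *)

theory Defs
  imports "HOL-Analysis.Analysis"
begin

text \<open>
  Agents are the elements of a finite type. Link intensities and link subsidies are indexed by
  ordered pairs of distinct agents; they are stored as square matrices whose (meaningless)
  diagonal entries are required to be zero.
\<close>

type_synonym 'n profile = "(real ^ 'n) \<times> (real ^ 'n ^ 'n)"
type_synonym 'n subsidy = "(real ^ 'n) \<times> (real ^ 'n ^ 'n)"

definition link :: "real ^ 'n ^ 'n::finite \<Rightarrow> 'n \<Rightarrow> 'n \<Rightarrow> real" where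
  "link g i j = (if i = j then 0 else g $ i $ j + g $ j $ i)"

definition base_utility ::
  "('n::finite \<Rightarrow> real) \<Rightarrow> real \<Rightarrow> ('n \<Rightarrow> 'n \<Rightarrow> real) \<Rightarrow> ('n \<Rightarrow> 'n \<Rightarrow> real) \<Rightarrow> 'n \<Rightarrow> 'n profile \<Rightarrow> real"
  where
  "base_utility b \<rho> s f i = (\<lambda>(a, g).
     b i * a $ i + \<rho> * (\<Sum>j\<in>UNIV - {i}. link g i j * a $ i * a $ j) - (a $ i)\<^sup>2 / 2
     + (\<Sum>j\<in>UNIV - {i}. s i j * link g i j)
     - (\<Sum>j\<in>UNIV - {i}. f i j * (g $ i $ j)\<^sup>2 / 2))"

definition subsidized_utility ::
  "('n::finite \<Rightarrow> real) \<Rightarrow> real \<Rightarrow> ('n \<Rightarrow> 'n \<Rightarrow> real) \<Rightarrow> ('n \<Rightarrow> 'n \<Rightarrow> real) \<Rightarrow> 'n subsidy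
     \<Rightarrow> 'n \<Rightarrow> 'n profile \<Rightarrow> real"
  where
  "subsidized_utility b \<rho> s f = (\<lambda>(\<beta>, \<sigma>) i (a, g).
     base_utility b \<rho> s f i (a, g) + \<beta> $ i * a $ i
     + (\<Sum>j\<in>UNIV - {i}. \<sigma> $ i $ j * link g i j))"

definition payment :: "'n::finite subsidy \<Rightarrow> 'n profile \<Rightarrow> real" where
  "payment = (\<lambda>(\<beta>, \<sigma>) (a, g).
     (\<Sum>i\<in>UNIV. \<beta> $ i * a $ i) + (\<Sum>i\<in>UNIV. \<Sum>j\<in>UNIV - {i}. \<sigma> $ i $ j * link g i j))"

definition actions :: "(real ^ 'n::finite) set" where
  "actions = {a. \<forall>i. 0 \<le> a $ i}"

definition intensities :: "'n::finite \<Rightarrow> (real ^ 'n) set" where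
  "intensities i = {\<gamma>. (\<forall>j. 0 \<le> \<gamma> $ j) \<and> \<gamma> $ i = 0}"

definition profiles :: "'n::finite profile set" where
  "profiles = {(a, g). a \<in> actions \<and> (\<forall>i. g $ i \<in> intensities i)}"

definition subsidies :: "'n::finite subsidy set" where
  "subsidies = {(\<beta>, \<sigma>). (\<forall>i. 0 \<le> \<beta> $ i) \<and> (\<forall>i j. 0 \<le> \<sigma> $ i $ j) \<and> (\<forall>i. \<sigma> $ i $ i = 0)}"

definition set_coord :: "'a ^ 'n::finite \<Rightarrow> 'n \<Rightarrow> 'a \<Rightarrow> 'a ^ 'n" where
  "set_coord v k x = (\<chi> i. if i = k then x else v $ i)"

definition nash ::
  "('n::finite \<Rightarrow> real) \<Rightarrow> real \<Rightarrow> ('n \<Rightarrow> 'n \<Rightarrow> real) \<Rightarrow> ('n \<Rightarrow> 'n \<Rightarrow> real) \<Rightarrow> 'n subsidy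
     \<Rightarrow> 'n profile \<Rightarrow> bool"
  where
  "nash b \<rho> s f \<tau> = (\<lambda>(a, g). (a, g) \<in> profiles \<and>
     (\<forall>i. \<forall>x\<ge>0. \<forall>\<gamma>\<in>intensities i.
        subsidized_utility b \<rho> s f \<tau> i (set_coord a i x, set_coord g i \<gamma>)
          \<le> subsidized_utility b \<rho> s f \<tau> i (a, g)))"

definition has_equilibrium ::
  "('n::finite \<Rightarrow> real) \<Rightarrow> real \<Rightarrow> ('n \<Rightarrow> 'n \<Rightarrow> real) \<Rightarrow> ('n \<Rightarrow> 'n \<Rightarrow> real) \<Rightarrow> 'n subsidy \<Rightarrow> bool"
  where
  "has_equilibrium b \<rho> s f \<tau> \<longleftrightarrow> (\<exists>p. nash b \<rho> s f \<tau> p)"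

text \<open>
  A selection is a total function whose value is arbitrary (and never used as an equilibrium)
  at subsidies without a pure Nash equilibrium.
\<close>

definition equilibrium_selection ::
  "('n::finite \<Rightarrow> real) \<Rightarrow> real \<Rightarrow> ('n \<Rightarrow> 'n \<Rightarrow> real) \<Rightarrow> ('n \<Rightarrow> 'n \<Rightarrow> real)
     \<Rightarrow> ('n subsidy \<Rightarrow> 'n profile) \<Rightarrow> bool"
  where
  "equilibrium_selection b \<rho> s f sel \<longleftrightarrow>
     (\<forall>\<tau>\<in>subsidies. has_equilibrium b \<rho> s f \<tau> \<longrightarrow> nash b \<rho> s f \<tau> (sel \<tau>))"

text \<open>
  Subsidies without an equilibrium carry welfare minus infinity, hence they are not competitors
  in the maximization.
\<close>

definition optimal_subsidy ::
  "('n::finite \<Rightarrow> real) \<Rightarrow> real \<Rightarrow> ('n \<Rightarrow> 'n \<Rightarrow> real) \<Rightarrow> ('n \<Rightarrow> 'n \<Rightarrow> real)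
     \<Rightarrow> ('n subsidy \<Rightarrow> 'n profile) \<Rightarrow> (real ^ 'n \<Rightarrow> real) \<Rightarrow> real \<Rightarrow> 'n subsidy \<Rightarrow> bool"
  where
  "optimal_subsidy b \<rho> s f sel W B \<tau> \<longleftrightarrow>
     \<tau> \<in> subsidies \<and> has_equilibrium b \<rho> s f \<tau> \<and> payment \<tau> (sel \<tau>) \<le> B \<and>
     (\<forall>\<tau>'\<in>subsidies. has_equilibrium b \<rho> s f \<tau>' \<and> payment \<tau>' (sel \<tau>') \<le> B
        \<longrightarrow> W (fst (sel \<tau>')) \<le> W (fst (sel \<tau>)))"

text \<open>
  Welfare is only meaningful on nonnegative action vectors; its derivative is taken relative to
  that set.
\<close>

definition planner_objective :: "(real ^ 'n::finite \<Rightarrow> real) \<Rightarrow> bool" where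
  "planner_objective W \<longleftrightarrow>
     W differentiable_on actions \<and>
     (\<forall>a\<in>actions. \<forall>k. strict_mono_on {0..} (\<lambda>x. W (set_coord a k x)))"

text \<open>Being defined near a subsidy includes that equilibria exist there.\<close>

definition selection_differentiable_near ::
  "('n::finite \<Rightarrow> real) \<Rightarrow> real \<Rightarrow> ('n \<Rightarrow> 'n \<Rightarrow> real) \<Rightarrow> ('n \<Rightarrow> 'n \<Rightarrow> real)
     \<Rightarrow> ('n subsidy \<Rightarrow> 'n profile) \<Rightarrow> 'n subsidy \<Rightarrow> bool"
  where
  "selection_differentiable_near b \<rho> s f sel \<tau> \<longleftrightarrow>
     (\<exists>N. open N \<and> \<tau> \<in> N \<and>
       (\<forall>\<tau>'\<in>N \<inter> subsidies. has_equilibrium b \<rho> s f \<tau>' \<and> sel differentiable (at \<tau>' within subsidies)))"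

definition lagrangian ::
  "('n::finite subsidy \<Rightarrow> 'n profile) \<Rightarrow> (real ^ 'n \<Rightarrow> real) \<Rightarrow> real \<Rightarrow> 'n subsidy \<Rightarrow> real" where
  "lagrangian sel W l \<tau> = W (fst (sel \<tau>)) - l * payment \<tau> (sel \<tau>)"

text \<open>
  Partial derivatives are taken within the half-line of nonnegative values: they are two-sided at
  a positive coordinate and right-sided at a zero coordinate.
\<close>

definition budget_strictly_binds ::
  "('n::finite subsidy \<Rightarrow> 'n profile) \<Rightarrow> (real ^ 'n \<Rightarrow> real) \<Rightarrow> real \<Rightarrow> 'n subsidy \<Rightarrow> bool"
  where
  "budget_strictly_binds sel W B = (\<lambda>(\<beta>, \<sigma>).
     payment (\<beta>, \<sigma>) (sel (\<beta>, \<sigma>)) = B \<and>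
     (\<exists>l>0.
       (\<forall>k. \<exists>d. ((\<lambda>t. lagrangian sel W l (set_coord \<beta> k t, \<sigma>)) has_real_derivative d)
                   (at (\<beta> $ k) within {0..}) \<and>
              d \<le> 0 \<and> (\<beta> $ k > 0 \<longrightarrow> d = 0)) \<and>
       (\<forall>k m. k \<noteq> m \<longrightarrow>
          (\<exists>d. ((\<lambda>t. lagrangian sel W l (\<beta>, set_coord \<sigma> k (set_coord (\<sigma> $ k) m t)))
                  has_real_derivative d) (at (\<sigma> $ k $ m) within {0..}) \<and>
             d \<le> 0 \<and> (\<sigma> $ k $ m > 0 \<longrightarrow> d = 0)))))"

end

theory Submission
  imports Defs
begin

text \<open>
  If \<open>\<sigma> $ i $ j > 0\<close>, trade a marginal unit of that link subsidy for the action subsidies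
  \<open>\<rho> * a $ j / f i j\<close> to \<open>i\<close> and \<open>\<rho> * a $ i / f i j\<close> to \<open>j\<close>, which compensate the
  two agents for the weaker link. With the actions held fixed, the payment changes at rate
  \<open>- 2 * (s i j + \<sigma> $ i $ j + \<sigma> $ j $ i) / f i j < 0\<close>, so welfare is unchanged while money is
  saved, against the first-order conditions.

  It remains to see that the selected actions really do not respond to this trade. The linearised
  equilibrium conditions have the form \<open>system (da d) = rhs d\<close>, and pure action subsidies \<open>h\<close> give
  \<open>system (da (h, 0)) = h\<close>. Hence \<open>system\<close> is onto, therefore injective, and the two sides of the
  trade, having equal right-hand sides, have equal effects on actions.
\<close>

subsection \<open>First-order conditions in equilibrium\<close>

lemma nash_profile:
  assumes "nash b \<rho> s f \<tau> (a, g)"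
  shows "0 \<le> a $ k" "0 \<le> g $ k $ l" "g $ k \<in> intensities k"
proof -
  have "(a, g) \<in> profiles" using assms unfolding nash_def prod.case by (rule conjunct1)
  then show "0 \<le> a $ k" "0 \<le> g $ k $ l" "g $ k \<in> intensities k"
    by (auto simp: profiles_def actions_def intensities_def)
qed

lemma nash_deviation:
  assumes "nash b \<rho> s f \<tau> (a, g)" "x \<ge> 0" "\<gamma> \<in> intensities i"
  shows "subsidized_utility b \<rho> s f \<tau> i (set_coord a i x, set_coord g i \<gamma>)
    \<le> subsidized_utility b \<rho> s f \<tau> i (a, g)"
  using assms(1)[unfolded nash_def prod.case] assms(2,3) by blast

text \<open>With the intensities held fixed, utility is a concave quadratic in the own action. Its
  vertex \<open>c\<close> is positive, hence a feasible deviation, and comparing \<open>c\<close>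
  with \<open>a $ k\<close> leaves only a square, which must vanish.\<close>

lemma nash_action:
  fixes b :: "'n::finite \<Rightarrow> real"
  assumes "nash b \<rho> s f (\<beta>, \<sigma>) (a, g)" "(\<beta>, \<sigma>) \<in> subsidies" "\<And>k. b k > 0" "\<rho> > 0"
  shows "a $ k = b k + \<beta> $ k + \<rho> * (\<Sum>l\<in>UNIV - {k}. link g k l * a $ l)" "a $ k > 0"
proof -
  define c where "c = b k + \<beta> $ k + \<rho> * (\<Sum>l\<in>UNIV - {k}. link g k l * a $ l)"
  note nn = nash_profile[OF assms(1)]
  have "0 \<le> (\<Sum>l\<in>UNIV - {k}. link g k l * a $ l)"
    by (intro sum_nonneg mult_nonneg_nonneg) (auto simp: link_def nn)
  moreover have "0 \<le> \<beta> $ k" using assms(2) by (auto simp: subsidies_def)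
  ultimately have "c > 0"
    using assms(3)[of k] assms(4) unfolding c_def by (simp add: add_pos_nonneg)
  have "subsidized_utility b \<rho> s f (\<beta>, \<sigma>) k (set_coord a k c, set_coord g k (g $ k))
          \<le> subsidized_utility b \<rho> s f (\<beta>, \<sigma>) k (a, g)"
    using nash_deviation[OF assms(1) _ nn(3)] \<open>c > 0\<close> by simp
  moreover have "set_coord g k (g $ k) = g" by (auto simp: set_coord_def vec_eq_iff)
  moreover have u: "subsidized_utility b \<rho> s f (\<beta>, \<sigma>) k (set_coord a k x, g)
      = c * x - x\<^sup>2 / 2 + (\<Sum>l\<in>UNIV - {k}. s k l * link g k l)
        - (\<Sum>l\<in>UNIV - {k}. f k l * (g $ k $ l)\<^sup>2 / 2)
        + (\<Sum>l\<in>UNIV - {k}. \<sigma> $ k $ l * link g k l)" for x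
  proof -
    have "(\<Sum>l\<in>UNIV - {k}. link g k l * set_coord a k x $ k * set_coord a k x $ l)
        = x * (\<Sum>l\<in>UNIV - {k}. link g k l * a $ l)"
      by (auto simp: sum_distrib_left set_coord_def intro!: sum.cong)
    then show ?thesis
      by (simp add: subsidized_utility_def base_utility_def c_def algebra_simps)
         (simp add: set_coord_def)
  qed
  moreover have "set_coord a k (a $ k) = a" by (auto simp: set_coord_def vec_eq_iff)
  ultimately have "c * c - c\<^sup>2 / 2 \<le> c * a $ k - (a $ k)\<^sup>2 / 2"
    using u[of "a $ k"] u[of c] by simp
  then have "(a $ k - c)\<^sup>2 \<le> 0" by (simp add: power2_eq_square algebra_simps)
  then have "a $ k = c" by simp
  then show "a $ k = b k + \<beta> $ k + \<rho> * (\<Sum>l\<in>UNIV - {k}. link g k l * a $ l)" "a $ k > 0"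
    using \<open>c > 0\<close> by (simp_all add: c_def)
qed

text \<open>Only deviations in a single intensity are tested: along them utility is a concave
  parabola, and nonnegativity turns its vertex into a positive part.\<close>

lemma nash_intensity:
  fixes b :: "'n::finite \<Rightarrow> real"
  assumes "nash b \<rho> s f (\<beta>, \<sigma>) (a, g)" "k \<noteq> l" "f k l > 0"
  shows "f k l * g $ k $ l = max 0 (\<rho> * a $ k * a $ l + s k l + \<sigma> $ k $ l)"
proof -
  define c where "c = \<rho> * a $ k * a $ l + s k l + \<sigma> $ k $ l"
  note nn = nash_profile[OF assms(1)]
  \<comment> \<open>The maximiser of \<open>c * y - f k l * y\<^sup>2 / 2\<close> over nonnegative
    \<open>y\<close>.\<close>
  define x where "x = max 0 c / f k l"
  define G where "G y = set_coord g k (set_coord (g $ k) l y)" for y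
  have "set_coord (g $ k) l x \<in> intensities k"
    using nn(3) assms(2,3) by (auto simp: intensities_def set_coord_def x_def)
  then have "subsidized_utility b \<rho> s f (\<beta>, \<sigma>) k (set_coord a k (a $ k), G x)
          \<le> subsidized_utility b \<rho> s f (\<beta>, \<sigma>) k (a, g)"
    unfolding G_def by (rule nash_deviation[OF assms(1) nn(1)])
  moreover have "set_coord a k (a $ k) = a" by (auto simp: set_coord_def vec_eq_iff)
  moreover have "G (g $ k $ l) = g" by (auto simp: G_def set_coord_def vec_eq_iff)
  ultimately have le: "subsidized_utility b \<rho> s f (\<beta>, \<sigma>) k (a, G x)
      \<le> subsidized_utility b \<rho> s f (\<beta>, \<sigma>) k (a, G (g $ k $ l))" by simp
  \<comment> \<open>Only the summand for \<open>l\<close> depends on \<open>y\<close>, and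
    \<open>g $ l $ k\<close> stays put because the partner chooses it; \<open>G 0\<close> fixes the
    constant.\<close>
  have u: "subsidized_utility b \<rho> s f (\<beta>, \<sigma>) k (a, G y)
      = subsidized_utility b \<rho> s f (\<beta>, \<sigma>) k (a, G 0) + c * y - f k l * y\<^sup>2 / 2" for y
  proof -
    have split: "(\<Sum>m\<in>UNIV - {k}. h m) = h l + (\<Sum>m\<in>UNIV - {k, l}. h m)" for h :: "'n \<Rightarrow> real"
    proof -
      have "UNIV - {k} - {l} = UNIV - {k, l}" by auto
      then show ?thesis using assms(2) sum.remove[of "UNIV - {k}" l h] by simp
    qed
    have entry: "link (G y) k l = y + g $ l $ k" "G y $ k $ l = y" for y
      using assms(2) by (auto simp: link_def G_def set_coord_def)
    have other: "link (G y) k m = link g k m" "G y $ k $ m = g $ k $ m" if "m \<in> UNIV - {k, l}" for m y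
      using that by (auto simp: link_def G_def set_coord_def)
    have sums: "(\<Sum>m\<in>UNIV - {k, l}. link (G y) k m * a $ k * a $ m)
        = (\<Sum>m\<in>UNIV - {k, l}. link g k m * a $ k * a $ m)"
      "(\<Sum>m\<in>UNIV - {k, l}. s k m * link (G y) k m) = (\<Sum>m\<in>UNIV - {k, l}. s k m * link g k m)"
      "(\<Sum>m\<in>UNIV - {k, l}. \<sigma> $ k $ m * link (G y) k m)
        = (\<Sum>m\<in>UNIV - {k, l}. \<sigma> $ k $ m * link g k m)"
      "(\<Sum>m\<in>UNIV - {k, l}. f k m * (G y $ k $ m)\<^sup>2 / 2)
        = (\<Sum>m\<in>UNIV - {k, l}. f k m * (g $ k $ m)\<^sup>2 / 2)" for y
      by (auto intro!: sum.cong simp: other)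
    show ?thesis
      unfolding subsidized_utility_def base_utility_def
      by (simp add: split entry sums c_def) (simp add: algebra_simps)
  qed
  have *: "c * x - f k l * x\<^sup>2 / 2 \<le> c * g $ k $ l - f k l * (g $ k $ l)\<^sup>2 / 2"
    using le unfolding u[of x] u[of "g $ k $ l"] by linarith
  show ?thesis
  proof (cases "c \<ge> 0")
    case True
    then have c: "c = f k l * x" using assms(3) by (simp add: x_def)
    have "f k l * (g $ k $ l - x)\<^sup>2 \<le> 0"
      using * unfolding c by (simp add: power2_eq_square algebra_simps)
    then have "g $ k $ l = x"
      using assms(3) by (simp add: mult_le_0_iff)
    then show ?thesis using c True by (simp add: c_def)
  next
    case False
    then have "x = 0" by (simp add: x_def)
    then have "0 \<le> c * g $ k $ l - f k l * (g $ k $ l)\<^sup>2 / 2" using * by simp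
    moreover have "0 \<le> f k l * (g $ k $ l)\<^sup>2" using assms(3) by simp
    ultimately have "0 \<le> c * g $ k $ l" by simp
    then have "g $ k $ l = 0" using False nn(2)[of k l] by (simp add: zero_le_mult_iff)
    then show ?thesis using False by (simp add: c_def)
  qed
qed

subsection \<open>One-sided derivatives\<close>

text \<open>If \<open>X\<close> is positive at some \<open>e\<close> of the cone, adding a multiple
  of \<open>e\<close> moves any \<open>d\<close> to where the positive part agrees with
  \<open>X\<close>, and linearity cancels the shift. Otherwise \<open>X\<close> is nonpositive on
  the whole cone.\<close>

lemma positive_part_linear_cases:
  fixes L X :: "'a::real_vector \<Rightarrow> real"
  assumes "linear L" "linear X"
    and cone: "\<And>d e. d \<in> K \<Longrightarrow> e \<in> K \<Longrightarrow> d + e \<in> K" "\<And>d t. d \<in> K \<Longrightarrow> 0 \<le> t \<Longrightarrow> t *\<^sub>R d \<in> K"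
    and L: "\<And>d. d \<in> K \<Longrightarrow> L d = max 0 (X d)"
  shows "(\<forall>d\<in>K. L d = X d) \<or> (\<forall>d\<in>K. L d = 0)"
proof (cases "\<exists>d\<in>K. X d > 0")
  case True
  then obtain e where e: "e \<in> K" "X e > 0" by blast
  have "L d = X d" if d: "d \<in> K" for d
  proof -
    \<comment> \<open>Chosen so that \<open>X (d + t *\<^sub>R e) = X d + \<bar>X d\<bar>\<close>,
      which is nonnegative.\<close>
    define t where "t = \<bar>X d\<bar> / X e"
    have t: "0 \<le> t" using e by (simp add: t_def)
    have "L (d + t *\<^sub>R e) = max 0 (X (d + t *\<^sub>R e))"
      using L cone d e t by blast
    moreover have "X (d + t *\<^sub>R e) = X d + \<bar>X d\<bar>"
      using e by (simp add: linear_add[OF assms(2)] linear_cmul[OF assms(2)] t_def)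
    moreover have "L (d + t *\<^sub>R e) = L d + \<bar>X d\<bar>"
      using e L[OF e(1)] by (simp add: linear_add[OF assms(1)] linear_cmul[OF assms(1)] t_def)
    ultimately show ?thesis by (simp add: max_def split: if_splits)
  qed
  then show ?thesis by blast
next
  case False
  then show ?thesis using L by (auto simp: not_less max_def)
qed

text \<open>Zero is a limit point of the half-line. Agreement is asked for in \<open>nhds 0\<close>
  because the difference quotients also involve the values at 0.\<close>

lemma right_derivative_unique:
  fixes h :: "real \<Rightarrow> real"
  assumes "(h has_real_derivative y) (at 0 within {0..})"
    and "(k has_real_derivative z) (at 0 within {0..})"
    and "eventually (\<lambda>t. t \<ge> 0 \<longrightarrow> h t = k t) (nhds 0)"
  shows "y = z"
proof -
  have nb: "at (0::real) within {0..} \<noteq> bot"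
    by (simp add: at_within_Ici_at_right)
  have h0: "h 0 = k 0" using eventually_nhds_x_imp_x[OF assms(3)] by simp
  have "((\<lambda>t. (h t - h 0) / (t - 0)) \<longlongrightarrow> y) (at 0 within {0..})"
    using assms(1) by (simp add: has_field_derivative_iff)
  moreover have "eventually (\<lambda>t. (h t - h 0) / (t - 0) = (k t - k 0) / (t - 0)) (at 0 within {0..})"
    using assms(3) h0 by (auto simp: eventually_at_filter elim!: eventually_mono)
  ultimately have "((\<lambda>t. (k t - k 0) / (t - 0)) \<longlongrightarrow> y) (at 0 within {0..})"
    by (rule Lim_transform_eventually)
  moreover have "((\<lambda>t. (k t - k 0) / (t - 0)) \<longlongrightarrow> z) (at 0 within {0..})"
    using assms(2) by (simp add: has_field_derivative_iff)
  ultimately show ?thesis using tendsto_unique nb by blast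
qed

text \<open>Carries the coordinate derivatives of the first-order conditions to the start of a path;
  the shift by \<open>x\<close> keeps the half-line inside itself.\<close>

lemma derivative_shift_to_zero:
  assumes "(h has_real_derivative d) (at x within {0..})" "x \<ge> 0"
  shows "((\<lambda>t. h (x + t)) has_real_derivative d) (at 0 within {0..})"
proof -
  have "((\<lambda>t. x + t) has_real_derivative 1) (at 0 within {0..})"
    by (auto intro!: derivative_eq_intros)
  moreover have "(h has_real_derivative d) (at (x + 0) within (\<lambda>t. x + t) ` {0..})"
    using assms by (auto intro: DERIV_subset)
  ultimately show ?thesis
    using DERIV_chain2 DERIV_image_chain[of h d "\<lambda>t. x + t" 0 "{0..}" 1] by (simp add: o_def)
qed

text \<open>Away from the kink, continuity fixes the sign of \<open>x\<close> for small
  \<open>t\<close>. At the kink, division by positive \<open>t\<close> commutes with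
  \<open>max 0\<close>, so the quotient of the positive part is the positive part of the
  quotient.\<close>

lemma right_derivative_positive_part:
  fixes x y :: "real \<Rightarrow> real"
  assumes x: "(x has_real_derivative X) (at 0 within {0..})"
    and y: "(y has_real_derivative Y) (at 0 within {0..})"
    and eq: "eventually (\<lambda>t. t \<ge> 0 \<longrightarrow> y t = max 0 (x t)) (nhds 0)"
  shows "x 0 > 0 \<Longrightarrow> Y = X" "x 0 < 0 \<Longrightarrow> Y = 0" "x 0 = 0 \<Longrightarrow> Y = max 0 X"
proof -
  have cont: "(x \<longlongrightarrow> x 0) (at 0 within {0..})"
    using DERIV_continuous[OF x] by (simp add: continuous_within)
  \<comment> \<open>Adds the point 0 to a property known on the punctured half-line.\<close>
  have ev: "eventually (\<lambda>t. t \<ge> 0 \<longrightarrow> P (x t)) (nhds 0)"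
    if "eventually (\<lambda>t. P (x t)) (at 0 within {0..})" "P (x 0)" for P
    using that by (auto simp: eventually_at_filter elim!: eventually_mono)
  {
    assume "x 0 > 0"
    then have "eventually (\<lambda>t. t \<ge> 0 \<longrightarrow> x t > 0) (nhds 0)"
      using order_tendstoD(1)[OF cont] ev[of "\<lambda>z. z > 0"] by blast
    then have "eventually (\<lambda>t. t \<ge> 0 \<longrightarrow> y t = x t) (nhds 0)"
      using eq by eventually_elim auto
    then show "Y = X" using right_derivative_unique[OF y x] by blast
  next
    assume "x 0 < 0"
    then have "eventually (\<lambda>t. t \<ge> 0 \<longrightarrow> x t < 0) (nhds 0)"
      using order_tendstoD(2)[OF cont] ev[of "\<lambda>z. z < 0"] by blast
    then have "eventually (\<lambda>t. t \<ge> 0 \<longrightarrow> y t = 0) (nhds 0)"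
      using eq by eventually_elim auto
    then show "Y = 0" using right_derivative_unique[OF y, of "\<lambda>_. 0"] by auto
  next
    assume x0: "x 0 = 0"
    have "((\<lambda>t. x t / t) \<longlongrightarrow> X) (at 0 within {0..})"
      using x x0 by (simp add: has_field_derivative_iff)
    then have "((\<lambda>t. max 0 (x t / t)) \<longlongrightarrow> max 0 X) (at 0 within {0..})"
      by (intro tendsto_intros)
    moreover have "eventually (\<lambda>t. max 0 (x t / t) = max 0 (x t) / t) (at 0 within {0..})"
      by (auto simp: eventually_at_filter max_def zero_le_divide_iff)
    ultimately have "((\<lambda>t. max 0 (x t) / t) \<longlongrightarrow> max 0 X) (at 0 within {0..})"
      by (rule Lim_transform_eventually)
    then have "((\<lambda>t. max 0 (x t)) has_real_derivative max 0 X) (at 0 within {0..})"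
      using x0 by (simp add: has_field_derivative_iff)
    then show "Y = max 0 X" using right_derivative_unique[OF y _ eq] by blast
  }
qed

section \<open>Linearity of links and the cone of subsidies\<close>

lemma link_linear_simps:
  "link (g + h) k l = link g k l + link h k l"
  "link (t *\<^sub>R g) k l = t * link g k l"
  by (auto simp: link_def algebra_simps)

lemma bounded_linear_link: "bounded_linear (\<lambda>p :: 'n::finite profile. link (snd p) k l)"
  unfolding linear_conv_bounded_linear[symmetric]
  by (rule linearI) (simp_all add: link_linear_simps)

lemma subsidies_cone:
  "d \<in> subsidies \<Longrightarrow> e \<in> subsidies \<Longrightarrow> d + e \<in> subsidies"
  "d \<in> subsidies \<Longrightarrow> 0 \<le> t \<Longrightarrow> t *\<^sub>R d \<in> subsidies"
  by (auto simp: subsidies_def)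

subsection \<open>The linearised equilibrium\<close>

locale smooth_equilibrium =
  fixes b :: "'n::finite \<Rightarrow> real" and \<rho> :: real and s f :: "'n \<Rightarrow> 'n \<Rightarrow> real"
    and sel :: "'n subsidy \<Rightarrow> 'n profile" and \<beta> :: "real ^ 'n" and \<sigma> :: "real ^ 'n ^ 'n"
    and D :: "'n subsidy \<Rightarrow> 'n profile" and a :: "real ^ 'n" and g :: "real ^ 'n ^ 'n"
  assumes b_pos: "b k > 0" and rho_pos: "\<rho> > 0"
    and f_sym: "k \<noteq> l \<Longrightarrow> f k l = f l k" and f_pos: "k \<noteq> l \<Longrightarrow> f k l > 0"
    and s_sym: "k \<noteq> l \<Longrightarrow> s k l = s l k"
    and sub: "(\<beta>, \<sigma>) \<in> subsidies"
    and near: "eventually (\<lambda>\<tau>. \<tau> \<in> subsidies \<longrightarrow> nash b \<rho> s f \<tau> (sel \<tau>)) (nhds (\<beta>, \<sigma>))"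
    and D: "(sel has_derivative D) (at (\<beta>, \<sigma>) within subsidies)"
    and sel: "sel (\<beta>, \<sigma>) = (a, g)"
begin

text \<open>Directions \<open>d\<close> are drawn from the cone \<open>subsidies\<close>, so that
  the ray stays feasible for \<open>t \<ge> 0\<close> even where coordinates of the current subsidy
  are zero.\<close>

abbreviation path :: "'n subsidy \<Rightarrow> real \<Rightarrow> 'n subsidy" where
  "path d t \<equiv> (\<beta>, \<sigma>) + t *\<^sub>R d"

abbreviation da :: "'n subsidy \<Rightarrow> real ^ 'n" where "da d \<equiv> fst (D d)"
abbreviation dg :: "'n subsidy \<Rightarrow> real ^ 'n ^ 'n" where "dg d \<equiv> snd (D d)"

lemma linear_D: "linear D"
  using D by (simp add: has_derivative_def bounded_linear.linear)

lemmas D_simps = linear_add[OF linear_D] linear_cmul[OF linear_D]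

lemma path_sub: "d \<in> subsidies \<Longrightarrow> t \<ge> 0 \<Longrightarrow> path d t \<in> subsidies"
  using sub subsidies_cone by blast

lemma near_path:
  assumes "d \<in> subsidies"
  shows "eventually (\<lambda>t. t \<ge> 0 \<longrightarrow> path d t \<in> subsidies \<and> nash b \<rho> s f (path d t) (sel (path d t)))
           (nhds 0)"
proof -
  have "filterlim (path d) (nhds (path d 0)) (nhds 0)"
    by (intro tendsto_intros) (auto intro!: filterlim_ident)
  then have "eventually (\<lambda>t. path d t \<in> subsidies \<longrightarrow> nash b \<rho> s f (path d t) (sel (path d t))) (nhds 0)"
    using near eventually_compose_filterlim[of _ "nhds (\<beta>, \<sigma>)" "path d"] by simp
  then show ?thesis by (rule eventually_mono) (use path_sub[OF assms] in blast)
qed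

lemma nash_here: "nash b \<rho> s f (\<beta>, \<sigma>) (a, g)"
  using eventually_nhds_x_imp_x[OF near] sub sel by simp

lemma a_pos: "a $ k > 0"
  using nash_action(2)[OF nash_here sub b_pos rho_pos] .

lemma sel_path:
  assumes "d \<in> subsidies"
  shows "((\<lambda>t. sel (path d t)) has_vector_derivative D d) (at 0 within {0..})"
proof -
  have "(path d has_derivative (\<lambda>t. 0 + t *\<^sub>R d)) (at 0 within {0..})"
    by (intro has_derivative_add has_derivative_const has_derivative_scaleR_left has_derivative_ident)
  moreover have "(sel has_derivative D) (at (path d 0) within path d ` {0..})"
  proof (rule has_derivative_subset)
    show "(sel has_derivative D) (at (path d 0) within subsidies)" using D by simp
    show "path d ` {0..} \<subseteq> subsidies"
      using path_sub[OF assms] by (intro image_subsetI) simp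
  qed
  ultimately have "((\<lambda>t. sel (path d t)) has_derivative (\<lambda>t. D (0 + t *\<^sub>R d))) (at 0 within {0..})"
    by (rule has_derivative_in_compose)
  then show ?thesis
    unfolding has_vector_derivative_def add_0 linear_cmul[OF linear_D] .
qed

lemma path_component:
  assumes "d \<in> subsidies" "bounded_linear h"
  shows "((\<lambda>t. h (sel (path d t))) has_real_derivative h (D d)) (at 0 within {0..})"
  using bounded_linear.has_vector_derivative[OF assms(2) sel_path[OF assms(1)]]
  by (simp add: has_real_derivative_iff_has_vector_derivative)

lemma path_action:
  "d \<in> subsidies \<Longrightarrow>
    ((\<lambda>t. fst (sel (path d t)) $ k) has_real_derivative da d $ k) (at 0 within {0..})"
  by (rule path_component[where h = "\<lambda>p. fst p $ k"])
     (auto intro!: bounded_linear_compose[OF bounded_linear_vec_nth] bounded_linear_fst)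

lemma path_intensity:
  "d \<in> subsidies \<Longrightarrow>
    ((\<lambda>t. snd (sel (path d t)) $ k $ l) has_real_derivative dg d $ k $ l) (at 0 within {0..})"
  by (rule path_component[where h = "\<lambda>p. snd p $ k $ l"])
     (auto intro!: bounded_linear_compose[OF bounded_linear_vec_nth] bounded_linear_snd)

lemma path_link:
  "d \<in> subsidies \<Longrightarrow>
    ((\<lambda>t. link (snd (sel (path d t))) k l) has_real_derivative link (dg d) k l) (at 0 within {0..})"
  using path_component[OF _ bounded_linear_link] .

text \<open>The condition of \<open>nash_action\<close> holds for all small \<open>t \<ge> 0\<close>
  along the path, so its two sides have the same right derivative at 0.\<close>

lemma action_response:
  assumes d: "d \<in> subsidies"
  shows "da d $ k = fst d $ k
     + \<rho> * (\<Sum>l\<in>UNIV - {k}. link (dg d) k l * a $ l + link g k l * da d $ l)"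
proof (rule right_derivative_unique[OF path_action[OF d]])
  let ?c = "\<lambda>t. sel (path d t)"
  show "((\<lambda>t. b k + (\<beta> $ k + t * fst d $ k)
      + \<rho> * (\<Sum>l\<in>UNIV - {k}. link (snd (?c t)) k l * fst (?c t) $ l)) has_real_derivative
      fst d $ k + \<rho> * (\<Sum>l\<in>UNIV - {k}. link (dg d) k l * a $ l + link g k l * da d $ l))
      (at 0 within {0..})"
    by (rule derivative_eq_intros refl path_link[OF d] path_action[OF d])+
       (simp add: sel algebra_simps)
  show "eventually (\<lambda>t. t \<ge> 0 \<longrightarrow> fst (?c t) $ k = b k + (\<beta> $ k + t * fst d $ k)
      + \<rho> * (\<Sum>l\<in>UNIV - {k}. link (snd (?c t)) k l * fst (?c t) $ l)) (nhds 0)"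
    using near_path[OF d]
  proof eventually_elim
    case (elim t)
    show ?case
    proof
      assume "t \<ge> 0"
      with elim have *: "path d t \<in> subsidies" "nash b \<rho> s f (path d t) (?c t)" by auto
      have "path d t = (\<beta> + t *\<^sub>R fst d, \<sigma> + t *\<^sub>R snd d)" by (cases d) simp
      then show "fst (?c t) $ k = b k + (\<beta> $ k + t * fst d $ k)
        + \<rho> * (\<Sum>l\<in>UNIV - {k}. link (snd (?c t)) k l * fst (?c t) $ l)"
        using nash_action(1)[of b \<rho> s f "\<beta> + t *\<^sub>R fst d" "\<sigma> + t *\<^sub>R snd d" "fst (?c t)" "snd (?c t)" k] *
          b_pos rho_pos by simp
    qed
  qed
qed

text \<open>The derivative along \<open>d\<close> of the marginal value, before cost, of the
  intensity \<open>g $ k $ l\<close> to agent \<open>k\<close>.\<close>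

definition demand :: "'n \<Rightarrow> 'n \<Rightarrow> 'n subsidy \<Rightarrow> real" where
  "demand k l d = \<rho> * (a $ k * da d $ l + a $ l * da d $ k) + snd d $ k $ l"

text \<open>The formula of \<open>nash_intensity\<close> holds along the path for small
  \<open>t \<ge> 0\<close>; the sign of \<open>x\<close> decides how its positive part
  differentiates.\<close>

lemma intensity_response:
  assumes d: "d \<in> subsidies" and "k \<noteq> l"
  defines "x \<equiv> \<rho> * a $ k * a $ l + s k l + \<sigma> $ k $ l"
  shows "x > 0 \<Longrightarrow> f k l * dg d $ k $ l = demand k l d"
    and "x < 0 \<Longrightarrow> f k l * dg d $ k $ l = 0"
    and "x = 0 \<Longrightarrow> f k l * dg d $ k $ l = max 0 (demand k l d)"
proof -
  let ?c = "\<lambda>t. sel (path d t)"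
  let ?x = "\<lambda>t. \<rho> * fst (?c t) $ k * fst (?c t) $ l + s k l + (\<sigma> $ k $ l + t * snd d $ k $ l)"
  have X: "(?x has_real_derivative demand k l d) (at 0 within {0..})"
    by (rule derivative_eq_intros refl path_action[OF d])+
       (simp add: sel demand_def algebra_simps)
  have Y: "((\<lambda>t. f k l * snd (?c t) $ k $ l) has_real_derivative f k l * dg d $ k $ l)
      (at 0 within {0..})"
    by (rule derivative_eq_intros refl path_intensity[OF d])+ simp
  have "eventually (\<lambda>t. t \<ge> 0 \<longrightarrow> f k l * snd (?c t) $ k $ l = max 0 (?x t)) (nhds 0)"
    using near_path[OF d]
  proof eventually_elim
    case (elim t)
    show ?case
    proof
      assume "t \<ge> 0"
      with elim have *: "nash b \<rho> s f (path d t) (?c t)" by auto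
      have "path d t = (\<beta> + t *\<^sub>R fst d, \<sigma> + t *\<^sub>R snd d)" by (cases d) simp
      then show "f k l * snd (?c t) $ k $ l = max 0 (?x t)"
        using nash_intensity[of b \<rho> s f "\<beta> + t *\<^sub>R fst d" "\<sigma> + t *\<^sub>R snd d" "fst (?c t)" "snd (?c t)" k l] *
          \<open>k \<noteq> l\<close> f_pos by simp
    qed
  qed
  note r = right_derivative_positive_part[OF X Y this]
  have "?x 0 = x" by (simp add: sel x_def)
  then show "x > 0 \<Longrightarrow> f k l * dg d $ k $ l = demand k l d"
    and "x < 0 \<Longrightarrow> f k l * dg d $ k $ l = 0"
    and "x = 0 \<Longrightarrow> f k l * dg d $ k $ l = max 0 (demand k l d)"
    using r by simp_all
qed

text \<open>A link whose marginal value vanishes sits at the kink of the positive part. Since the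
  equilibrium responds linearly to subsidies, it uses a single branch of the kink in all feasible
  directions.\<close>

lemma intensity_response_cases:
  assumes "k \<noteq> l"
  shows "(\<forall>d\<in>subsidies. f k l * dg d $ k $ l = demand k l d)
       \<or> (\<forall>d\<in>subsidies. f k l * dg d $ k $ l = 0)"
proof (cases "\<rho> * a $ k * a $ l + s k l + \<sigma> $ k $ l" "0::real" rule: linorder_cases)
  case equal
  have "linear (\<lambda>d. f k l * dg d $ k $ l)" "linear (demand k l)"
    by (rule linearI; simp add: D_simps demand_def algebra_simps)+
  then show ?thesis
    by (rule positive_part_linear_cases[OF _ _ subsidies_cone
          intensity_response(3)[OF _ assms equal]])
next
  case less
  then show ?thesis by (intro disjI2 ballI intensity_response(2)[OF _ assms])
next
  case greater
  then show ?thesis by (intro disjI1 ballI intensity_response(1)[OF _ assms])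
qed

text \<open>One coefficient for all feasible directions. Where both branches hold,
  \<open>demand k l\<close> vanishes on the cone and either value would serve.\<close>

definition slope :: "'n \<Rightarrow> 'n \<Rightarrow> real" where
  "slope k l = (if \<forall>d\<in>subsidies. f k l * dg d $ k $ l = demand k l d then 1 / f k l else 0)"

lemma dg_slope:
  assumes "d \<in> subsidies" "k \<noteq> l"
  shows "dg d $ k $ l = slope k l * demand k l d"
proof -
  have "f k l > 0" using f_pos[OF assms(2)] .
  moreover have "f k l * dg d $ k $ l = (f k l * slope k l) * demand k l d"
  proof (cases "\<forall>d\<in>subsidies. f k l * dg d $ k $ l = demand k l d")
    case True
    then show ?thesis using assms(1) \<open>f k l > 0\<close> by (simp add: slope_def)
  next
    case False
    then have "slope k l = 0" unfolding slope_def by (rule if_not_P)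
    moreover have "f k l * dg d $ k $ l = 0"
      using False intensity_response_cases[OF assms(2)] assms(1) by blast
    ultimately show ?thesis by simp
  qed
  ultimately show ?thesis by simp
qed

section \<open>The linear system for the action responses\<close>

definition system :: "real ^ 'n \<Rightarrow> real ^ 'n" where
  "system y = (\<chi> k. y $ k - \<rho> * (\<Sum>l\<in>UNIV - {k}.
     (slope k l + slope l k) * \<rho> * (a $ k * y $ l + a $ l * y $ k) * a $ l + link g k l * y $ l))"

text \<open>Eliminating the intensity responses from \<open>action_response\<close> by
  \<open>dg_slope\<close> leaves equations in \<open>da d\<close> alone: \<open>system\<close>
  collects its terms with coefficients independent of \<open>d\<close>, and the direct effects of
  the subsidies stay on the right.\<close>

lemma system_da:
  assumes d: "d \<in> subsidies"
  shows "system (da d) $ k = fst d $ k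
    + \<rho> * (\<Sum>l\<in>UNIV - {k}. (slope k l * snd d $ k $ l + slope l k * snd d $ l $ k) * a $ l)"
proof -
  have "link (dg d) k l = (slope k l + slope l k) * \<rho> * (a $ k * da d $ l + a $ l * da d $ k)
      + (slope k l * snd d $ k $ l + slope l k * snd d $ l $ k)" if "l \<in> UNIV - {k}" for l
    using that d by (simp add: link_def dg_slope demand_def algebra_simps)
  then have "(\<Sum>l\<in>UNIV - {k}. link (dg d) k l * a $ l + link g k l * da d $ l)
     = (\<Sum>l\<in>UNIV - {k}. (slope k l + slope l k) * \<rho> * (a $ k * da d $ l + a $ l * da d $ k) * a $ l
          + link g k l * da d $ l)
     + (\<Sum>l\<in>UNIV - {k}. (slope k l * snd d $ k $ l + slope l k * snd d $ l $ k) * a $ l)"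
    unfolding sum.distrib[symmetric] by (intro sum.cong) (auto simp: algebra_simps)
  moreover have "x = h + r * S \<Longrightarrow> S = S1 + S2 \<Longrightarrow> x - r * S1 = h + r * S2" for x h r S S1 S2 :: real
    by (simp add: algebra_simps)
  ultimately show ?thesis
    using action_response[OF d, of k] unfolding system_def vec_lambda_beta by blast
qed

lemma linear_system: "linear system"
proof -
  define T where "T y k l = (slope k l + slope l k) * \<rho> * (a $ k * y $ l + a $ l * y $ k) * a $ l
    + link g k l * y $ l" for y k l
  have T: "T (x + y) k l = T x k l + T y k l" "T (t *\<^sub>R x) k l = t * T x k l" for x y t k l
    by (simp_all add: T_def algebra_simps)
  show ?thesis
    unfolding system_def T_def[symmetric]
    by (rule linearI; simp add: vec_eq_iff T sum.distrib sum_distrib_left[symmetric];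
        simp add: algebra_simps)
qed

lemma system_inj: "inj system"
proof -
  have lin: "linear (\<lambda>h. da (h, 0))"
  proof (rule linearI)
    show "da (x + y, 0) = da (x, 0) + da (y, 0)" for x y
      using linear_add[OF linear_D, of "(x, 0)" "(y, 0)"] by simp
    show "da (t *\<^sub>R x, 0) = t *\<^sub>R da (x, 0)" for t x
      using linear_cmul[OF linear_D, of t "(x, 0)"] by simp
  qed
  \<comment> \<open>The equation \<open>system_da\<close> is available only on the cone. Standard
    basis vectors are nonnegative and so belong to it; linearity then covers every
    \<open>h\<close>.\<close>
  have "system \<circ> (\<lambda>h. da (h, 0)) = id"
  proof (rule linear_eq_stdbasis)
    show "linear (system \<circ> (\<lambda>h. da (h, 0)))" using lin linear_system by (rule linear_compose)
    show "linear (id :: real ^ 'n \<Rightarrow> _)" by (rule linear_id)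
    fix h :: "real ^ 'n" assume "h \<in> Basis"
    then have "(h, 0) \<in> subsidies" by (auto simp: subsidies_def Basis_vec_def axis_def)
    then show "(system \<circ> (\<lambda>h. da (h, 0))) h = id h"
      by (simp add: vec_eq_iff system_da)
  qed
  \<comment> \<open>In finite dimension a right inverse of a linear endomorphism is also a left
    inverse.\<close>
  then have "(\<lambda>h. da (h, 0)) \<circ> system = id"
    using linear_inverse_left[OF linear_system lin] by simp
  then show ?thesis by (metis inj_on_id inj_on_imageI2)
qed

subsection \<open>Marginal payments and the Lagrangian\<close>

definition payment_response :: "'n subsidy \<Rightarrow> real" where
  "payment_response d = (\<Sum>k\<in>UNIV. fst d $ k * a $ k + \<beta> $ k * da d $ k)
    + (\<Sum>k\<in>UNIV. \<Sum>l\<in>UNIV - {k}. snd d $ k $ l * link g k l + \<sigma> $ k $ l * link (dg d) k l)"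

lemma path_payment:
  assumes d: "d \<in> subsidies"
  shows "((\<lambda>t. payment (path d t) (sel (path d t))) has_real_derivative payment_response d)
    (at 0 within {0..})"
proof -
  let ?c = "\<lambda>t. sel (path d t)"
  have eq: "payment (path d t) (?c t) = (\<Sum>k\<in>UNIV. (\<beta> $ k + t * fst d $ k) * fst (?c t) $ k)
    + (\<Sum>k\<in>UNIV. \<Sum>l\<in>UNIV - {k}. (\<sigma> $ k $ l + t * snd d $ k $ l) * link (snd (?c t)) k l)" for t
    unfolding payment_def by (simp add: split_beta)
  show ?thesis
    unfolding eq payment_response_def
    by (rule derivative_eq_intros refl path_link[OF d] path_action[OF d])+
       (simp add: sel algebra_simps)
qed

text \<open>Gives the slope of the Lagrangian in every feasible direction, not only in the
  coordinate directions of the first-order conditions, by an expression linear in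
  \<open>d\<close>.\<close>

lemma path_lagrangian:
  assumes d: "d \<in> subsidies" and W: "(W has_derivative W') (at a)"
  shows "((\<lambda>t. lagrangian sel W l (path d t)) has_real_derivative W' (da d) - l * payment_response d)
    (at 0 within {0..})"
proof -
  have "((\<lambda>t. fst (sel (path d t))) has_vector_derivative da d) (at 0 within {0..})"
    using bounded_linear.has_vector_derivative[OF bounded_linear_fst sel_path[OF d]] .
  then have "((\<lambda>t. fst (sel (path d t))) has_derivative (\<lambda>t. t *\<^sub>R da d)) (at 0 within {0..})"
    by (simp add: has_vector_derivative_def)
  then have "((\<lambda>t. W (fst (sel (path d t)))) has_derivative (\<lambda>t. W' (t *\<^sub>R da d))) (at 0 within {0..})"
    by (rule has_derivative_compose) (use W sel in simp)
  moreover have "W' (t *\<^sub>R da d) = t * W' (da d)" for t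
    using W by (simp add: has_derivative_def linear_cmul[OF bounded_linear.linear])
  ultimately have "((\<lambda>t. W (fst (sel (path d t)))) has_real_derivative W' (da d)) (at 0 within {0..})"
    by (simp add: has_field_derivative_def mult_commute_abs)
  then show ?thesis
    unfolding lagrangian_def
    by (auto intro!: DERIV_diff DERIV_cmult path_payment[OF d])
qed

lemma linear_payment_response: "linear payment_response"
proof -
  define S where "S d k = fst d $ k * a $ k + \<beta> $ k * da d $ k" for d k
  define T where "T d k l = snd d $ k $ l * link g k l + \<sigma> $ k $ l * link (dg d) k l" for d k l
  have S: "S (x + y) k = S x k + S y k" "S (t *\<^sub>R x) k = t * S x k" for x y t k
    by (simp_all add: S_def D_simps algebra_simps)
  have T: "T (x + y) k l = T x k l + T y k l" "T (t *\<^sub>R x) k l = t * T x k l" for x y t k l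
    by (simp_all add: T_def D_simps link_linear_simps algebra_simps)
  show ?thesis
    unfolding payment_response_def S_def[symmetric] T_def[symmetric]
    by (rule linearI; simp add: S T sum.distrib sum_distrib_left[symmetric];
        simp add: algebra_simps)
qed

section \<open>Trading a link subsidy for action subsidies\<close>

lemma single_link_mem: "(0, axis i (axis j 1)) \<in> subsidies" if "i \<noteq> j"
  using that by (auto simp: subsidies_def axis_def)

text \<open>At fixed actions, one more unit of subsidy on an active \<open>g $ i $ j\<close> raises
  it by \<open>1 / f i j\<close>, hence the marginal return to action by
  \<open>\<rho> * a $ j / f i j\<close> for \<open>i\<close> and by
  \<open>\<rho> * a $ i / f i j\<close> for \<open>j\<close>.\<close>

definition replacement :: "'n \<Rightarrow> 'n \<Rightarrow> real ^ 'n" where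
  "replacement i j = (\<rho> * a $ j / f i j) *\<^sub>R axis i 1 + (\<rho> * a $ i / f i j) *\<^sub>R axis j 1"

context
  fixes i j
  assumes ij: "i \<noteq> j" and active: "\<rho> * a $ i * a $ j + s i j + \<sigma> $ i $ j > 0"
begin

abbreviation dlink where "dlink \<equiv> (0, axis i (axis j 1)) :: 'n subsidy"
abbreviation drepl where "drepl \<equiv> (replacement i j, 0) :: 'n subsidy"

lemma drepl_mem: "drepl \<in> subsidies"
  using f_pos[OF ij] rho_pos a_pos[THEN less_imp_le]
  by (auto simp: subsidies_def replacement_def axis_def)

lemma slope_active: "slope i j = 1 / f i j"
  using intensity_response(1)[OF _ ij active] by (simp add: slope_def)

lemma same_actions: "da drepl = da dlink"
proof (rule injD[OF system_inj], subst vec_eq_iff, intro allI)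
  fix k
  have "system (da drepl) $ k = replacement i j $ k"
    by (simp add: system_da[OF drepl_mem])
  moreover have "system (da dlink) $ k = replacement i j $ k"
  proof -
    \<comment> \<open>A link is shared, so \<open>slope i j\<close> enters two rows:
      \<open>k = i\<close> through \<open>l = j\<close>, and \<open>k = j\<close> through
      \<open>l = i\<close>.\<close>
    have "(\<Sum>l\<in>UNIV - {k}. (slope k l * snd dlink $ k $ l + slope l k * snd dlink $ l $ k) * a $ l)
      = (\<Sum>l\<in>UNIV - {k}. (if l = j then if k = i then a $ j / f i j else 0 else 0)
          + (if l = i then if k = j then a $ i / f i j else 0 else 0))"
      by (intro sum.cong) (auto simp: axis_def slope_active)
    also have "\<dots> = (if k = i then a $ j / f i j else 0) + (if k = j then a $ i / f i j else 0)"
      using ij by (auto simp: sum.distrib)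
    finally show ?thesis
      unfolding system_da[OF single_link_mem[OF ij]] using ij
      by (auto simp: replacement_def axis_def)
  qed
  ultimately show "system (da drepl) $ k = system (da dlink) $ k" by simp
qed

text \<open>With equal action responses the two demands differ only by the direct subsidy at the
  pair \<open>i\<close>, \<open>j\<close>, where the slope is \<open>1 / f i j\<close>.\<close>

lemma intensity_difference:
  "k \<noteq> l \<Longrightarrow> dg drepl $ k $ l - dg dlink $ k $ l = - (if k = i \<and> l = j then 1 / f i j else 0)"
proof -
  assume kl: "k \<noteq> l"
  have "dg drepl $ k $ l - dg dlink $ k $ l
      = slope k l * (demand k l drepl - demand k l dlink)"
    by (simp only: dg_slope[OF drepl_mem kl] dg_slope[OF single_link_mem[OF ij] kl] right_diff_distrib)
  also have "demand k l drepl - demand k l dlink = - axis i (axis j 1) $ k $ l"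
    unfolding demand_def same_actions by simp
  finally show ?thesis using slope_active by (auto simp: axis_def)
qed

text \<open>Equal action responses cancel the \<open>\<beta>\<close> terms. What remains is the cost
  of the action subsidies, the unit subsidy saved on the existing link, and the payments to both
  agents saved because the link weakens by \<open>1 / f i j\<close>.\<close>

lemma payment_difference:
  "payment_response drepl - payment_response dlink
     = 2 * \<rho> * a $ i * a $ j / f i j - link g i j - (\<sigma> $ i $ j + \<sigma> $ j $ i) / f i j"
proof -
  have pair_sum: "(\<Sum>k\<in>UNIV. \<Sum>l\<in>UNIV - {k}. if k = p \<and> l = q then x k l else 0) = x p q"
    if "p \<noteq> q" for p q :: 'n and x :: "'n \<Rightarrow> 'n \<Rightarrow> real"
  proof -
    have "(\<Sum>l\<in>UNIV - {k}. if k = p \<and> l = q then x k l else 0) = (if k = p then x p q else 0)" for k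
      using that by (cases "k = p") auto
    then show ?thesis by simp
  qed
  \<comment> \<open>Link strength is symmetric, so the change in the one intensity is felt at both
    ordered pairs.\<close>
  have links: "link (dg drepl) k l - link (dg dlink) k l
      = - (if k = i \<and> l = j then 1 / f i j else 0) - (if k = j \<and> l = i then 1 / f i j else 0)"
    if "k \<noteq> l" for k l
  proof -
    have "link (dg drepl) k l - link (dg dlink) k l
        = (dg drepl $ k $ l - dg dlink $ k $ l) + (dg drepl $ l $ k - dg dlink $ l $ k)"
      using that unfolding link_def by (simp only: if_False add_diff_add)
    then show ?thesis
      unfolding intensity_difference[OF that] intensity_difference[OF that[symmetric]]
      by (simp only: conj_commute[of "k = j"] add_uminus_conv_diff)
  qed
  have "(\<Sum>k\<in>UNIV. fst drepl $ k * a $ k + \<beta> $ k * da drepl $ k)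
      - (\<Sum>k\<in>UNIV. fst dlink $ k * a $ k + \<beta> $ k * da dlink $ k)
    = (\<Sum>k\<in>UNIV. replacement i j $ k * a $ k)"
    unfolding sum_subtractf[symmetric] same_actions by simp
  moreover have "(\<Sum>k\<in>UNIV. \<Sum>l\<in>UNIV - {k}.
        snd drepl $ k $ l * link g k l + \<sigma> $ k $ l * link (dg drepl) k l)
      - (\<Sum>k\<in>UNIV. \<Sum>l\<in>UNIV - {k}.
        snd dlink $ k $ l * link g k l + \<sigma> $ k $ l * link (dg dlink) k l)
    = (\<Sum>k\<in>UNIV. \<Sum>l\<in>UNIV - {k}. - axis i (axis j 1) $ k $ l * link g k l
            + \<sigma> $ k $ l * (link (dg drepl) k l - link (dg dlink) k l))"
    unfolding sum_subtractf[symmetric]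
    by (intro sum.cong refl) (simp add: right_diff_distrib)
  ultimately have "payment_response drepl - payment_response dlink
    = (\<Sum>k\<in>UNIV. replacement i j $ k * a $ k)
      + (\<Sum>k\<in>UNIV. \<Sum>l\<in>UNIV - {k}. - axis i (axis j 1) $ k $ l * link g k l
            + \<sigma> $ k $ l * (link (dg drepl) k l - link (dg dlink) k l))"
    unfolding payment_response_def add_diff_add by (simp only:)
  also have "(\<Sum>k\<in>UNIV. \<Sum>l\<in>UNIV - {k}. - axis i (axis j 1) $ k $ l * link g k l
            + \<sigma> $ k $ l * (link (dg drepl) k l - link (dg dlink) k l))
    = (\<Sum>k\<in>UNIV. \<Sum>l\<in>UNIV - {k}. (if k = i \<and> l = j then - link g k l - \<sigma> $ k $ l / f i j else 0)
            + (if k = j \<and> l = i then - \<sigma> $ k $ l / f i j else 0))"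
  proof (intro sum.cong refl)
    fix k l :: 'n assume "l \<in> UNIV - {k}"
    then have kl: "k \<noteq> l" by simp
    show "- axis i (axis j 1) $ k $ l * link g k l
        + \<sigma> $ k $ l * (link (dg drepl) k l - link (dg dlink) k l)
      = (if k = i \<and> l = j then - link g k l - \<sigma> $ k $ l / f i j else 0)
        + (if k = j \<and> l = i then - \<sigma> $ k $ l / f i j else 0)"
      unfolding links[OF kl] using ij by (simp add: axis_def)
  qed
  also have "\<dots> = - link g i j - \<sigma> $ i $ j / f i j - \<sigma> $ j $ i / f i j"
    using ij by (simp add: sum.distrib pair_sum)
  also have "(\<Sum>k\<in>UNIV. replacement i j $ k * a $ k)
    = (\<Sum>k\<in>UNIV. (if k = i then \<rho> * a $ i * a $ j / f i j else 0)
        + (if k = j then \<rho> * a $ i * a $ j / f i j else 0))"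
    using ij by (intro sum.cong) (auto simp: replacement_def axis_def)
  also have "\<dots> = 2 * \<rho> * a $ i * a $ j / f i j"
    by (simp add: sum.distrib)
  finally show ?thesis by (simp add: add_divide_distrib)
qed

end

text \<open>Since \<open>s i j \<ge> 0\<close>, the marginal values of \<open>g $ i $ j\<close> and
  \<open>g $ j $ i\<close> are both positive, so neither is truncated and the symmetry of
  \<open>s\<close> and \<open>f\<close> makes their sum explicit. Substituting it cancels the terms
  in \<open>\<rho> * a $ i * a $ j\<close> from \<open>payment_difference\<close>.\<close>

lemma replacement_cheaper:
  assumes "i \<noteq> j" "s i j \<ge> 0" "\<sigma> $ i $ j > 0"
  shows "da (replacement i j, 0) = da (0, axis i (axis j 1))"
    and "payment_response (replacement i j, 0) < payment_response (0, axis i (axis j 1))"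
proof -
  have sg: "\<sigma> $ j $ i \<ge> 0" using sub by (simp add: subsidies_def)
  have prod: "\<rho> * a $ i * a $ j > 0" using rho_pos a_pos by simp
  have act: "\<rho> * a $ i * a $ j + s i j + \<sigma> $ i $ j > 0" using prod assms by simp
  show "da (replacement i j, 0) = da (0, axis i (axis j 1))"
    by (rule same_actions[OF assms(1) act])
  have f: "f i j > 0" "f j i = f i j" using f_pos f_sym assms(1) by auto
  have "f i j * link g i j = 2 * \<rho> * a $ i * a $ j + 2 * s i j + \<sigma> $ i $ j + \<sigma> $ j $ i"
    using nash_intensity[OF nash_here, of i j] nash_intensity[OF nash_here, of j i]
      assms f prod sg s_sym[of i j] by (simp add: link_def algebra_simps)
  then have "link g i j = (2 * \<rho> * a $ i * a $ j + 2 * s i j + \<sigma> $ i $ j + \<sigma> $ j $ i) / f i j"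
    using f(1) by (simp add: field_simps)
  then have "payment_response (replacement i j, 0) - payment_response (0, axis i (axis j 1))
    = - 2 * (s i j + \<sigma> $ i $ j + \<sigma> $ j $ i) / f i j"
    unfolding payment_difference[OF assms(1) act] by (simp add: diff_divide_distrib[symmetric] algebra_simps)
  also have "\<dots> < 0" using assms sg f by (simp add: divide_neg_pos)
  finally show "payment_response (replacement i j, 0) < payment_response (0, axis i (axis j 1))"
    by simp
qed

text \<open>If the link subsidy were positive, the Lagrangian would have slope 0 in its direction,
  and slope at most 0 along \<open>replacement\<close>, a nonnegative combination of action
  directions. But \<open>replacement\<close> induces the same actions for less money, which with
  \<open>l > 0\<close> makes its slope strictly larger.\<close>

lemma link_subsidy_zero:
  assumes W: "(W has_derivative W') (at a)"
    and binds: "budget_strictly_binds sel W B (\<beta>, \<sigma>)"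
    and ij: "i \<noteq> j" "s i j \<ge> 0"
  shows "\<sigma> $ i $ j = 0"
proof (rule ccontr)
  assume "\<sigma> $ i $ j \<noteq> 0"
  then have pos: "\<sigma> $ i $ j > 0" using sub by (auto simp: subsidies_def less_le)
  obtain l where l: "l > 0"
    and kb: "\<forall>k. \<exists>d. ((\<lambda>t. lagrangian sel W l (set_coord \<beta> k t, \<sigma>)) has_real_derivative d)
                   (at (\<beta> $ k) within {0..}) \<and> d \<le> 0 \<and> (\<beta> $ k > 0 \<longrightarrow> d = 0)"
    and ks: "\<forall>k m. k \<noteq> m \<longrightarrow>
        (\<exists>d. ((\<lambda>t. lagrangian sel W l (\<beta>, set_coord \<sigma> k (set_coord (\<sigma> $ k) m t)))
            has_real_derivative d) (at (\<sigma> $ k $ m) within {0..}) \<and>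
          d \<le> 0 \<and> (\<sigma> $ k $ m > 0 \<longrightarrow> d = 0))"
    using binds unfolding budget_strictly_binds_def prod.case
    by (elim conjE exE) (rule that)
  define L where "L d = W' (da d) - l * payment_response d" for d
  \<comment> \<open>The first-order conditions only assert that some derivative exists; uniqueness
    of right derivatives identifies it with \<open>L d\<close>.\<close>
  have deriv: "x = L d" if "d \<in> subsidies"
    "((\<lambda>t. lagrangian sel W l (path d t)) has_real_derivative x) (at 0 within {0..})" for x d
    using right_derivative_unique[OF that(2) path_lagrangian[OF that(1) W, of l]]
    by (simp add: L_def)
  have Lb: "L (axis k 1, 0) \<le> 0" for k
  proof -
    obtain d where d: "((\<lambda>t. lagrangian sel W l (set_coord \<beta> k t, \<sigma>)) has_real_derivative d)
                   (at (\<beta> $ k) within {0..})" "d \<le> 0" using kb by blast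
    have "(set_coord \<beta> k (\<beta> $ k + t), \<sigma>) = path (axis k 1, 0) t" for t
      by (auto simp: set_coord_def vec_eq_iff axis_def)
    then have "((\<lambda>t. lagrangian sel W l (path (axis k 1, 0) t)) has_real_derivative d)
       (at 0 within {0..})"
      using derivative_shift_to_zero[OF d(1)] sub by (simp add: subsidies_def)
    then have "d = L (axis k 1, 0)"
      by (rule deriv[rotated]) (auto simp: subsidies_def axis_def)
    then show ?thesis using d by simp
  qed
  have Ls: "L (0, axis i (axis j 1)) = 0"
  proof -
    have "((\<lambda>t. lagrangian sel W l (\<beta>, set_coord \<sigma> i (set_coord (\<sigma> $ i) j t)))
                  has_real_derivative 0) (at (\<sigma> $ i $ j) within {0..})"
      using ks[rule_format, OF ij(1)] pos by auto
    note d = derivative_shift_to_zero[OF this]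
    have "(\<beta>, set_coord \<sigma> i (set_coord (\<sigma> $ i) j (\<sigma> $ i $ j + t))) = path (0, axis i (axis j 1)) t" for t
      by (auto simp: set_coord_def vec_eq_iff axis_def)
    then have "((\<lambda>t. lagrangian sel W l (path (0, axis i (axis j 1)) t)) has_real_derivative 0)
       (at 0 within {0..})"
      using d pos by simp
    then show ?thesis using deriv[OF single_link_mem[OF ij(1)]] by simp
  qed
  have "linear W'" using W by (simp add: has_derivative_def bounded_linear.linear)
  then have lin: "linear L"
    using linear_payment_response
    by (intro linearI; simp add: L_def D_simps linear_add linear_cmul algebra_simps)
  have "(replacement i j, 0) = (\<rho> * a $ j / f i j) *\<^sub>R (axis i 1, 0)
      + (\<rho> * a $ i / f i j) *\<^sub>R (axis j 1, 0 :: real ^ 'n ^ 'n)"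
    by (simp add: replacement_def)
  then have "L (replacement i j, 0) = \<rho> * a $ j / f i j * L (axis i 1, 0)
      + \<rho> * a $ i / f i j * L (axis j 1, 0)"
    by (simp only: linear_add[OF lin] linear_cmul[OF lin] real_scaleR_def)
  also have "\<dots> \<le> 0"
    using rho_pos f_pos[OF ij(1)] a_pos[THEN less_imp_le] Lb
    by (intro add_nonpos_nonpos mult_nonneg_nonpos divide_nonneg_pos) auto
  finally have "L (replacement i j, 0) \<le> L (0, axis i (axis j 1))" using Ls by simp
  then show False
    using replacement_cheaper[OF ij pos] l by (simp add: L_def)
qed

end

section \<open>From the hypotheses on the game to the local analysis\<close>

lemma positive_interior_actions:
  fixes a :: "real ^ 'n::finite"
  assumes "\<And>k. a $ k > 0"
  shows "a \<in> interior actions"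
proof (rule interiorI)
  show "open (\<Inter>k. {a :: real ^ 'n. a $ k > 0})"
    by (intro open_INT) (auto intro!: open_Collect_less continuous_intros)
qed (use assms in \<open>auto simp: actions_def less_imp_le\<close>)

theorem theorem1:
  fixes b :: "'n::finite \<Rightarrow> real" and \<rho> :: real
    and s f :: "'n \<Rightarrow> 'n \<Rightarrow> real"
    and sel :: "(real ^ 'n) \<times> (real ^ 'n ^ 'n) \<Rightarrow> (real ^ 'n) \<times> (real ^ 'n ^ 'n)"
    and W :: "real ^ 'n \<Rightarrow> real" and B :: real
    and \<beta> :: "real ^ 'n" and \<sigma> :: "real ^ 'n ^ 'n"
    and i j :: 'n
  assumes "\<And>k. b k > 0" and "\<rho> > 0"
    and "\<And>k m. k \<noteq> m \<Longrightarrow> s k m = s m k"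
    and "\<And>k m. k \<noteq> m \<Longrightarrow> f k m = f m k"
    and "\<And>k m. k \<noteq> m \<Longrightarrow> f k m > 0"
    and "equilibrium_selection b \<rho> s f sel"
    and "planner_objective W" and "B > 0"
    and "optimal_subsidy b \<rho> s f sel W B (\<beta>, \<sigma>)"
    and "selection_differentiable_near b \<rho> s f sel (\<beta>, \<sigma>)"
    and "budget_strictly_binds sel W B (\<beta>, \<sigma>)"
    and "i \<noteq> j" and "s i j \<ge> 0"
  shows "\<sigma> $ i $ j = 0 \<and> \<sigma> $ j $ i = 0"
proof -
  have sub: "(\<beta>, \<sigma>) \<in> subsidies" using assms(9) by (simp add: optimal_subsidy_def)
  obtain N where N: "open N" "(\<beta>, \<sigma>) \<in> N"
    "\<And>\<tau>. \<tau> \<in> N \<inter> subsidies \<Longrightarrow> has_equilibrium b \<rho> s f \<tau> \<and> sel differentiable (at \<tau> within subsidies)"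
    using assms(10) unfolding selection_differentiable_near_def by blast
  have "eventually (\<lambda>\<tau>. \<tau> \<in> N) (nhds (\<beta>, \<sigma>))" using N by (rule_tac eventually_nhds_in_open)
  then have near: "eventually (\<lambda>\<tau>. \<tau> \<in> subsidies \<longrightarrow> nash b \<rho> s f \<tau> (sel \<tau>)) (nhds (\<beta>, \<sigma>))"
    by (rule eventually_mono) (use N(3) assms(6) in \<open>auto simp: equilibrium_selection_def\<close>)
  obtain D where D: "(sel has_derivative D) (at (\<beta>, \<sigma>) within subsidies)"
    using N sub by (auto simp: differentiable_def)
  obtain a g where ag: "sel (\<beta>, \<sigma>) = (a, g)" by fastforce
  interpret smooth_equilibrium b \<rho> s f sel \<beta> \<sigma> D a g
    by unfold_locales (use assms sub near D ag in auto)
  \<comment> \<open>Equilibrium actions are strictly positive, so the derivative of \<open>W\<close>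
    relative to the nonnegative orthant is an ordinary derivative at \<open>a\<close>.\<close>
  have int: "a \<in> interior actions" by (rule positive_interior_actions) (rule a_pos)
  then have "W differentiable (at a within actions)"
    using assms(7) interior_subset by (auto simp: planner_objective_def differentiable_on_def)
  then obtain W' where "(W has_derivative W') (at a)"
    using at_within_interior[OF int] by (auto simp: differentiable_def)
  \<comment> \<open>The entry for the reversed pair follows by swapping \<open>i\<close> and
    \<open>j\<close>, as \<open>s\<close> is symmetric.\<close>
  then show ?thesis
    using link_subsidy_zero assms(3)[OF assms(12)] assms(11-13) by metis
qed

end
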